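(* Let $\alpha_1\in(0,1)$, let $x_k\in\mathcal X_0$, let $Q_k\succ0$ be a symmetric positive definite $m\times m$ matrix, and write $\sigma_k:=\lambda_{\min}(Q_k)$ and $L_U:=L_h\beta_C+L_R^2\beta_s$. Let $$x_k^+=\arg\min_x F_{Q_k}(x;x_k),\qquad \mathrm{Pred}_k:=F(x_k)-F_{Q_k}(x_k^+;x_k),\qquad \mathrm{Act}_k:=F(x_k)-F(x_k^+),$$ and suppose $\mathrm{Pred}_k\neq0$. If $$\sigma_k\ \ge\ \frac{L_U}{2-\alpha_1},$$ then the trial point $x_k^+$ is accepted, i.e. $\rho_k:=\mathrm{Act}_k/\mathrm{Pred}_k\ge\alpha_1$.
   Context: **Problem.** $F(x)=g(x)+h(C(x))+s(R(x))$ on $\mathbb R^m$, where $g:\mathbb R^m\to\mathbb R\cup\{+\infty\}$ is proper, closed, convex; $h:\mathbb R^d\to\mathbb R$ is finite-valued, closed, convex; $C:\mathbb R^m\to\mathbb R^d$ and $s:\mathbb R^n\to\mathbb R$ are $\mathcal C^1$; $R=(r_1,\dots,r_n)$ with each $r_i:\mathbb R^m\to\mathbb R$ finite-valued, closed, convex. $\|\cdot\|$ is the Euclidean norm on vectors and the spectral norm on matrices; $\|u\|_Q^2:=u^\top Qu$. **Standing assumptions.** (1) Monotone-or-smooth: for each $\bar x\in\operatorname{dom}F$ there is a neighborhood $W$ of $R(\bar x)$ such that, for every $i$, if $r_i$ is not $\mathcal C^1$ on any neighborhood of $\bar x$ then $\nabla_i s(z)\ge0$ for all $z\in W$. (2)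 A starting point $x_0\in\operatorname{dom}F$ is fixed, and $\mathcal X_0:=\{x\in\operatorname{dom}F: F(x)\le F(x_0)\}$ is nonempty and compact. (3) $h$ is $L_h$-Lipschitz; $C$ has $\beta_C$-Lipschitz Jacobian; $s$ has $\beta_s$-Lipschitz gradient; each $r_i$ is $L_{r_i}$-Lipschitz, and $L_R:=\|(L_{r_1},\dots,L_{r_n})\|_2$. (4) Let $\mathcal I^-$ be the set of indices $i$ with $\nabla_i s(R(x))<0$ for some $x\in\mathcal X_0$. If $\mathcal I^-\ne\emptyset$, then $\|\nabla s(y)\|\le L_s$ for all $y\in\{R(x):F(x)\le F(x_0)\}$, and each $r_i$, $i\in\mathcal I^-$, is $\mathcal C^1$ with $\beta_{r_i}$-Lipschitz gradient. **Model.** For $x_k\in\mathcal X_0$, $$F(x;x_k)=g(x)+h\big(C(x_k)+\nabla C(x_k)(x-x_k)\big)+s(R(x_k))+\sum_{i=1}^n\nabla_i s(R(x_k))\,\Phi_i(x;x_k),$$ where $\Phi_i(x;x_k)=r_i(x)-r_i(x_k)$ if $\nabla_i s(R(x_k))\ge0$, and $\Phi_i(x;x_k)=\nabla r_i(x_k)^\top(x-x_k)$ if $\nabla_i s(R(x_k))<0$. The function $F(\cdot;x_k)$ is convex. The proximal model is $F_{Q_k}(x;x_k)=F(x;x_k)+\tfrac12\|x-x_k\|_{Q_k}^2$. *)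

theory Defs
  imports "HOL-Analysis.Analysis"
begin

text \<open>Convexity and closedness of an extended-real-valued function are those of its epigraph.
  The HOL-Analysis constant \<^const>\<open>epigraph\<close> covers real-valued functions only.\<close>

definition ereal_epigraph :: "('a \<Rightarrow> ereal) \<Rightarrow> ('a \<times> real) set" where
  "ereal_epigraph f = {(x, t). f x \<le> ereal t}"

definition proper_fun :: "('a \<Rightarrow> ereal) \<Rightarrow> bool" where
  "proper_fun f \<longleftrightarrow> (\<forall>x. f x \<noteq> -\<infinity>) \<and> (\<exists>x. f x \<noteq> \<infinity>)"

definition proper_closed_convex :: "('a::real_normed_vector \<Rightarrow> ereal) \<Rightarrow> bool" where
  "proper_closed_convex f \<longleftrightarrow>
     proper_fun f \<and> closed (ereal_epigraph f) \<and> convex (ereal_epigraph f)"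

definition closed_convex :: "('a::real_normed_vector \<Rightarrow> real) \<Rightarrow> bool" where
  "closed_convex f \<longleftrightarrow> closed (epigraph UNIV f) \<and> convex_on UNIV f"

definition C1_on :: "('a::real_normed_vector \<Rightarrow> 'b::real_normed_vector) \<Rightarrow> 'a set \<Rightarrow> bool" where
  "C1_on f S \<longleftrightarrow>
     (\<exists>f'. (\<forall>x\<in>S. (f has_derivative blinfun_apply (f' x)) (at x)) \<and> continuous_on S f')"

text \<open>The value of \<open>grad f x\<close> is meaningful only where \<open>f\<close> is differentiable.\<close>

definition grad :: "('a::real_inner \<Rightarrow> real) \<Rightarrow> 'a \<Rightarrow> 'a" where
  "grad f x = (THE D. GDERIV f x :> D)"

lemma grad_eqI:
  assumes "GDERIV f x :> D"
  shows "grad f x = D"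
  unfolding grad_def
proof (rule the_equality)
  show "GDERIV f x :> D" by (rule assms)
next
  fix E assume "GDERIV f x :> E"
  then have "(\<lambda>h. inner h E) = (\<lambda>h. inner h D)"
    using assms has_derivative_unique unfolding gderiv_def by blast
  then show "E = D"
    by (metis vector_eq_ldot)
qed

definition spectral_norm :: "real^'m^'n \<Rightarrow> real" where
  "spectral_norm A = onorm ((*v) A)"

definition is_eigenvalue :: "real^'m^'m \<Rightarrow> real \<Rightarrow> bool" where
  "is_eigenvalue A l \<longleftrightarrow> (\<exists>v. v \<noteq> 0 \<and> A *v v = l *\<^sub>R v)"

text \<open>Used for symmetric matrices only, for which a least real eigenvalue exists.\<close>

definition lambda_min :: "real^'m^'m \<Rightarrow> real" where
  "lambda_min A = (LEAST l. is_eigenvalue A l)"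

definition sym_pos_def :: "real^'m^'m \<Rightarrow> bool" where
  "sym_pos_def A \<longleftrightarrow> transpose A = A \<and> (\<forall>v. v \<noteq> 0 \<longrightarrow> 0 < v \<bullet> (A *v v))"

definition Rmap :: "('n \<Rightarrow> real^'m \<Rightarrow> real) \<Rightarrow> real^'m \<Rightarrow> real^'n" where
  "Rmap r x = (\<chi> i. r i x)"

definition objective :: "(real^'m \<Rightarrow> ereal) \<Rightarrow> (real^'d \<Rightarrow> real) \<Rightarrow> (real^'m \<Rightarrow> real^'d) \<Rightarrow>
    (real^'n \<Rightarrow> real) \<Rightarrow> ('n \<Rightarrow> real^'m \<Rightarrow> real) \<Rightarrow> real^'m \<Rightarrow> ereal" where
  "objective g h C s r x = g x + ereal (h (C x)) + ereal (s (Rmap r x))"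

definition eff_dom :: "('a \<Rightarrow> ereal) \<Rightarrow> 'a set" where
  "eff_dom f = {x. f x < \<infinity>}"

definition level_set :: "('a \<Rightarrow> ereal) \<Rightarrow> 'a \<Rightarrow> 'a set" where
  "level_set f x0 = {x \<in> eff_dom f. f x \<le> f x0}"

definition monotone_or_smooth :: "(real^'m \<Rightarrow> ereal) \<Rightarrow> (real^'n \<Rightarrow> real) \<Rightarrow>
    ('n \<Rightarrow> real^'m \<Rightarrow> real) \<Rightarrow> bool" where
  "monotone_or_smooth F s r \<longleftrightarrow>
     (\<forall>x\<in>eff_dom F. \<exists>W. open W \<and> Rmap r x \<in> W \<and>
        (\<forall>i. \<not> (\<exists>U. open U \<and> x \<in> U \<and> C1_on (r i) U) \<longrightarrow> (\<forall>z\<in>W. 0 \<le> grad s z $ i)))"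

definition neg_indices :: "(real^'n \<Rightarrow> real) \<Rightarrow> ('n \<Rightarrow> real^'m \<Rightarrow> real) \<Rightarrow> (real^'m) set \<Rightarrow> 'n set" where
  "neg_indices s r X = {i. \<exists>x\<in>X. grad s (Rmap r x) $ i < 0}"

definition Phi :: "(real^'n \<Rightarrow> real) \<Rightarrow> ('n \<Rightarrow> real^'m \<Rightarrow> real) \<Rightarrow> real^'m \<Rightarrow> 'n \<Rightarrow> real^'m \<Rightarrow> real" where
  "Phi s r xk i x =
     (if 0 \<le> grad s (Rmap r xk) $ i then r i x - r i xk else grad (r i) xk \<bullet> (x - xk))"

definition model :: "(real^'m \<Rightarrow> ereal) \<Rightarrow> (real^'d \<Rightarrow> real) \<Rightarrow> (real^'m \<Rightarrow> real^'d) \<Rightarrow>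
    (real^'n \<Rightarrow> real) \<Rightarrow> ('n \<Rightarrow> real^'m \<Rightarrow> real) \<Rightarrow> real^'m \<Rightarrow> real^'m \<Rightarrow> ereal" where
  "model g h C s r xk x =
     g x + ereal (h (C xk + jacobian C (at xk) *v (x - xk))) + ereal (s (Rmap r xk))
       + ereal (\<Sum>i\<in>UNIV. grad s (Rmap r xk) $ i * Phi s r xk i x)"

definition prox_model :: "(real^'m \<Rightarrow> ereal) \<Rightarrow> (real^'d \<Rightarrow> real) \<Rightarrow> (real^'m \<Rightarrow> real^'d) \<Rightarrow>
    (real^'n \<Rightarrow> real) \<Rightarrow> ('n \<Rightarrow> real^'m \<Rightarrow> real) \<Rightarrow> real^'m^'m \<Rightarrow> real^'m \<Rightarrow> real^'m \<Rightarrow> ereal" where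
  "prox_model g h C s r Q xk x =
     model g h C s r xk x + ereal (1/2 * ((x - xk) \<bullet> (Q *v (x - xk))))"

end

theory Submission
  imports Defs
begin

text \<open>Write \<open>d\<close> for the step from \<open>xk\<close> to \<open>xp\<close> and \<open>q = d \<bullet> (Q *v d)\<close>. Two inequalities carry
  the proof.

  The first bounds the objective by its convex model. The model replaces \<open>C\<close> by its
  linearization, \<open>s\<close> by its linearization, and \<open>r i\<close> by its linearization wherever the partial
  derivative of \<open>s\<close> is negative. The first two replacements cost at most a Lipschitz constant
  times half a squared distance, and the third costs nothing because a convex function lies above
  its tangents and the weight is negative. Hence the objective at \<open>xp\<close> exceeds the model
  there by at most \<open>L_U/2 * (d \<bullet> d)\<close> (lemma \<open>finite_part_le_model\<close>).

  The second says that the minimizer of a convex function plus the quadratic \<open>q/2\<close> gains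
  more than optimality alone gives: the model without the quadratic decreases by at least \<open>q\<close>,
  so that \<open>Pred \<ge> q/2\<close> (lemma \<open>prox_minimizer_decrease\<close>).

  The first inequality gives \<open>Act \<ge> Pred + q/2 - L_U/2 * (d \<bullet> d)\<close>. Keeping \<open>alpha1 * Pred\<close> and
  using the second one for the rest of \<open>Pred\<close> leaves
  \<open>Act - alpha1 * Pred \<ge> ((2 - alpha1) * q - L_U * (d \<bullet> d)) / 2\<close>. Since
  \<open>q \<ge> lambda_min Q * (d \<bullet> d)\<close> (lemma \<open>lambda_min_rayleigh\<close>), the lower bound on the least
  eigenvalue makes the right-hand side nonnegative. Finally \<open>Pred \<ge> q/2 \<ge> 0\<close> and \<open>Pred \<noteq> 0\<close>
  allow division by \<open>Pred\<close>.\<close>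

section \<open>The least eigenvalue of a symmetric matrix\<close>

lemma inner_symmetric_matrix:
  fixes Q :: "real^'m^'m"
  assumes "transpose Q = Q"
  shows "u \<bullet> (Q *v w) = w \<bullet> (Q *v u)"
  by (metis assms dot_lmul_matrix inner_commute vector_transpose_matrix)

text \<open>A vector at which a positive semidefinite quadratic form vanishes minimizes the form,
  so the derivative of the form must vanish there; testing the direction \<open>A *v v\<close> itself
  turns this into \<open>A *v v = 0\<close>.\<close>

lemma psd_zero_imp_kernel:
  fixes A :: "real^'m^'m"
  assumes sym: "transpose A = A"
    and psd: "\<And>w. 0 \<le> w \<bullet> (A *v w)"
    and zero: "v \<bullet> (A *v v) = 0"
  shows "A *v v = 0"
proof (rule ccontr)
  define u where "u = A *v v"
  define b where "b = u \<bullet> (A *v u)"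
  assume "A *v v \<noteq> 0"
  then have uu: "0 < u \<bullet> u" by (simp add: u_def)
  have b: "0 \<le> b" unfolding b_def by (rule psd)
  have vAu: "v \<bullet> (A *v u) = u \<bullet> u"
    using inner_symmetric_matrix[OF sym, of v u] by (simp add: u_def)
  have quad: "0 \<le> 2 * t * (u \<bullet> u) + t\<^sup>2 * b" for t
  proof -
    have "(v + t *\<^sub>R u) \<bullet> (A *v (v + t *\<^sub>R u)) = 2 * t * (u \<bullet> u) + t\<^sup>2 * b"
      using vAu zero
      by (simp add: matrix_vector_right_distrib matrix_vector_mult_scaleR inner_add_left
          inner_add_right b_def power2_eq_square distrib_left mult.assoc flip: u_def)
    then show ?thesis using psd[of "v + t *\<^sub>R u"] by simp
  qed
  \<comment> \<open>A step of this length against \<open>u\<close> is short enough for the linear term to dominate.\<close>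
  define t where "t = - (u \<bullet> u) / (b + 1)"
  have "t * (b + 1) = - (u \<bullet> u)" using b by (simp add: t_def)
  then have "2 * t * (u \<bullet> u) + t\<^sup>2 * b = t * (u \<bullet> u) - t\<^sup>2"
    by algebra
  moreover have "t * (u \<bullet> u) < 0"
    using uu b by (simp add: t_def mult_neg_pos divide_neg_pos)
  ultimately show False using quad[of t] zero_le_power2[of t] by linarith
qed

text \<open>The minimum of the quadratic form over the compact unit sphere is attained, by the lemma
  above at an eigenvector, and no eigenvalue lies below it.\<close>

lemma lambda_min_rayleigh:
  fixes Q :: "real^'m^'m"
  assumes sym: "transpose Q = Q"
  shows "lambda_min Q * (w \<bullet> w) \<le> w \<bullet> (Q *v w)"
proof -
  define S where "S = sphere (0 :: real^'m) 1"
  have "continuous_on S (\<lambda>w. w \<bullet> (Q *v w))"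
    by (intro continuous_intros linear_continuous_on matrix_vector_mul_bounded_linear)
  moreover have "compact S" "S \<noteq> {}" by (auto simp: S_def)
  ultimately obtain v where v: "v \<in> S" and min: "\<And>w. w \<in> S \<Longrightarrow> v \<bullet> (Q *v v) \<le> w \<bullet> (Q *v w)"
    using continuous_attains_inf[of S "\<lambda>w. w \<bullet> (Q *v w)"] by blast
  define l where "l = v \<bullet> (Q *v v)"
  have ray: "l * (w \<bullet> w) \<le> w \<bullet> (Q *v w)" for w
  proof (cases "w = 0")
    case False
    have "l \<le> (w /\<^sub>R norm w) \<bullet> (Q *v (w /\<^sub>R norm w))"
      unfolding l_def using False by (intro min) (simp add: S_def)
    also have "\<dots> = (w \<bullet> (Q *v w)) / (w \<bullet> w)"
      by (simp add: matrix_vector_mult_scaleR dot_square_norm power2_eq_square field_simps)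
    finally show ?thesis using False by (simp add: field_simps)
  qed simp
  define A where "A = Q - l *\<^sub>R mat 1"
  have A: "A *v w = Q *v w - l *\<^sub>R w" for w
    by (simp add: A_def matrix_vector_mult_diff_rdistrib flip: scaleR_matrix_vector_assoc)
  have vv: "v \<bullet> v = 1" using v by (simp add: S_def dot_square_norm)
  have "A *v v = 0"
  proof (rule psd_zero_imp_kernel)
    show "transpose A = A"
      using sym by (auto simp: A_def transpose_def vec_eq_iff mat_def)
    show "0 \<le> w \<bullet> (A *v w)" for w
      using ray[of w] by (simp add: A inner_diff_right)
    show "v \<bullet> (A *v v) = 0"
      using vv by (simp add: A inner_diff_right l_def)
  qed
  then have "is_eigenvalue Q l"
    using vv unfolding is_eigenvalue_def by (intro exI[of _ v]) (auto simp: A)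
  moreover have "l \<le> e" if e: "is_eigenvalue Q e" for e
  proof -
    obtain u where "u \<noteq> 0" "Q *v u = e *\<^sub>R u" using e unfolding is_eigenvalue_def by blast
    then show ?thesis using ray[of u] by simp
  qed
  ultimately have "lambda_min Q = l"
    unfolding lambda_min_def by (rule Least_equality)
  then show ?thesis using ray by simp
qed

section \<open>First-order estimates\<close>

text \<open>Along the segment from \<open>x\<close> to \<open>y\<close>, the derivative of the linearization error at parameter \<open>t\<close>
  is at most \<open>\<beta> t\<close> times the squared length of the segment; integrating \<open>t\<close> over \<open>[0,1]\<close>
  gives the factor \<open>1/2\<close>. The mean value inequality with the majorant \<open>t\<^sup>2/2\<close> plays the part
  of the integral.\<close>

lemma linearization_error_le:
  fixes f :: "'a::real_normed_vector \<Rightarrow> 'b::real_normed_vector"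
  assumes deriv: "\<And>z. (f has_derivative f' z) (at z)"
    and lip: "\<And>z v. norm (f' z v - f' x v) \<le> \<beta> * norm (z - x) * norm v"
  shows "norm (f y - f x - f' x (y - x)) \<le> \<beta> / 2 * (norm (y - x))\<^sup>2"
proof -
  define d where "d = y - x"
  define e where "e t = f (x + t *\<^sub>R d) - t *\<^sub>R f' x d" for t
  have e': "(e has_vector_derivative f' (x + t *\<^sub>R d) d - f' x d) (at t)" for t
  proof -
    have "((\<lambda>t. x + t *\<^sub>R d) has_derivative (\<lambda>t. t *\<^sub>R d)) (at t)"
      by (auto intro!: derivative_eq_intros)
    then have "((\<lambda>t. f (x + t *\<^sub>R d)) has_derivative (\<lambda>s. f' (x + t *\<^sub>R d) (s *\<^sub>R d))) (at t)"
      using has_derivative_compose deriv by blast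
    moreover have "f' (x + t *\<^sub>R d) (s *\<^sub>R d) = s *\<^sub>R f' (x + t *\<^sub>R d) d" for s
      using deriv has_derivative_linear linear_scale by blast
    ultimately have "((\<lambda>t. f (x + t *\<^sub>R d)) has_vector_derivative f' (x + t *\<^sub>R d) d) (at t)"
      by (simp add: has_vector_derivative_def)
    then show ?thesis
      unfolding e_def by (auto intro!: derivative_eq_intros)
  qed
  have "norm (e 1 - e 0) \<le> \<beta> * (norm d)\<^sup>2 * 1\<^sup>2 / 2 - \<beta> * (norm d)\<^sup>2 * 0\<^sup>2 / 2"
  proof (rule differentiable_bound_general)
    show "continuous_on {0..1} e"
      by (meson continuous_at_imp_continuous_on e' has_vector_derivative_continuous)
    show "continuous_on {0..1} (\<lambda>t::real. \<beta> * (norm d)\<^sup>2 * t\<^sup>2 / 2)"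
      by (intro continuous_intros) auto
    show "(e has_vector_derivative f' (x + t *\<^sub>R d) d - f' x d) (at t)" for t
      by (rule e')
    show "((\<lambda>t. \<beta> * (norm d)\<^sup>2 * t\<^sup>2 / 2) has_vector_derivative \<beta> * (norm d)\<^sup>2 * t) (at t)" for t
      unfolding has_real_derivative_iff_has_vector_derivative[symmetric]
      by (auto intro!: derivative_eq_intros)
    show "norm (f' (x + t *\<^sub>R d) d - f' x d) \<le> \<beta> * (norm d)\<^sup>2 * t" if "0 < t" for t
      using lip[of "x + t *\<^sub>R d" d] that by (simp add: power2_eq_square mult_ac)
  qed simp
  then show ?thesis by (simp add: e_def d_def algebra_simps)
qed

lemma has_derivative_grad:
  fixes f :: "'a::euclidean_space \<Rightarrow> real"
  assumes "(f has_derivative f') (at x)"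
  shows "(f has_derivative (\<lambda>v. v \<bullet> grad f x)) (at x)"
proof -
  have "f' = (\<lambda>v. v \<bullet> adjoint f' 1)"
    using adjoint_works[OF has_derivative_linear[OF assms], of _ 1] by auto
  then have "GDERIV f x :> adjoint f' 1"
    using assms by (simp add: gderiv_def)
  with grad_eqI show ?thesis by (metis gderiv_def)
qed

lemma C1_on_has_derivative_grad:
  fixes f :: "'a::euclidean_space \<Rightarrow> real"
  assumes "C1_on f UNIV"
  shows "(f has_derivative (\<lambda>v. v \<bullet> grad f x)) (at x)"
  using assms has_derivative_grad unfolding C1_on_def by blast

lemma convex_on_affine_compose:
  fixes f :: "'b::real_vector \<Rightarrow> real"
  assumes f: "convex_on UNIV f" and T: "linear T"
  shows "convex_on UNIV (\<lambda>x. f (c + T (x - a)))"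
proof (rule convex_onI)
  fix t :: real and x y assume t: "0 < t" "t < 1"
  have "c + T ((1 - t) *\<^sub>R x + t *\<^sub>R y - a) = (1 - t) *\<^sub>R (c + T (x - a)) + t *\<^sub>R (c + T (y - a))"
    by (simp add: linear_add[OF T] linear_diff[OF T] linear_scale[OF T] algebra_simps)
  then show "f (c + T ((1 - t) *\<^sub>R x + t *\<^sub>R y - a))
      \<le> (1 - t) * f (c + T (x - a)) + t * f (c + T (y - a))"
    using convex_onD[OF f] t by simp
qed simp

text \<open>Restricting to the line through \<open>x\<close> and \<open>y\<close> reduces the claim to the tangent inequality for
  convex functions of one real variable.\<close>

lemma convex_ge_tangent:
  fixes f :: "'a::euclidean_space \<Rightarrow> real"
  assumes convex: "convex_on UNIV f"
    and deriv: "(f has_derivative (\<lambda>v. v \<bullet> grad f x)) (at x)"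
  shows "grad f x \<bullet> (y - x) \<le> f y - f x"
proof -
  define d where "d = y - x"
  have "linear (\<lambda>t::real. t *\<^sub>R d)" by (simp add: linear_iff scaleR_add_left)
  then have "convex_on UNIV (\<lambda>t::real. f (x + t *\<^sub>R d))"
    using convex_on_affine_compose[OF convex, of "\<lambda>t::real. t *\<^sub>R d" x 0] by simp
  moreover have "((\<lambda>t::real. f (x + t *\<^sub>R d)) has_real_derivative d \<bullet> grad f x) (at 0)"
  proof -
    have "((\<lambda>t::real. x + t *\<^sub>R d) has_derivative (\<lambda>t. t *\<^sub>R d)) (at 0)"
      by (auto intro!: derivative_eq_intros)
    moreover have "(f has_derivative (\<lambda>v. v \<bullet> grad f x)) (at (x + 0 *\<^sub>R d))"
      using deriv by simp
    ultimately have "((\<lambda>t::real. f (x + t *\<^sub>R d)) has_derivative (\<lambda>t. (t *\<^sub>R d) \<bullet> grad f x)) (at 0)"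
      using has_derivative_compose by fastforce
    then show ?thesis
      by (simp add: has_field_derivative_def mult.commute[of _ "d \<bullet> grad f x"])
  qed
  ultimately have "(d \<bullet> grad f x) * (1 - 0) \<le> f (x + 1 *\<^sub>R d) - f (x + 0 *\<^sub>R d)"
    by (intro convex_on_imp_above_tangent[where A = UNIV]) auto
  then show ?thesis by (simp add: d_def inner_commute)
qed

lemma Rmap_norm_diff_le:
  assumes lip: "\<And>i. (L i)-lipschitz_on UNIV (r i)"
  shows "norm (Rmap r y - Rmap r x) \<le> norm (\<chi> i. L i) * norm (y - x)"
proof -
  have "norm (Rmap r y - Rmap r x) \<le> norm (norm (y - x) *\<^sub>R (\<chi> i. L i))"
  proof (rule norm_le_componentwise_cart)
    fix i
    have "\<bar>r i y - r i x\<bar> \<le> L i * norm (y - x)"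
      using lipschitz_onD[OF lip, of y x] by (simp add: dist_norm)
    also have "\<dots> \<le> \<bar>norm (y - x) * L i\<bar>" by (simp add: mult.commute)
    finally show "norm ((Rmap r y - Rmap r x) $ i) \<le> norm ((norm (y - x) *\<^sub>R (\<chi> i. L i)) $ i)"
      by (simp add: Rmap_def)
  qed
  then show ?thesis by (simp add: mult.commute)
qed

section \<open>Decrease of the proximal model\<close>

lemma convex_ereal_epigraph_add:
  fixes f :: "'a::real_normed_vector \<Rightarrow> ereal"
  assumes f: "convex (ereal_epigraph f)" and p: "convex_on UNIV p"
  shows "convex (ereal_epigraph (\<lambda>x. f x + ereal (p x)))"
proof -
  have shift: "(x, t) \<in> ereal_epigraph (\<lambda>x. f x + ereal (p x)) \<longleftrightarrow> (x, t - p x) \<in> ereal_epigraph f"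
    for x t
    by (cases "f x") (auto simp: ereal_epigraph_def)
  show ?thesis
    unfolding convex_alt
  proof (intro ballI allI impI; clarify)
    fix x a y b and u :: real
    assume a: "(x, a) \<in> ereal_epigraph (\<lambda>x. f x + ereal (p x))"
      and b: "(y, b) \<in> ereal_epigraph (\<lambda>x. f x + ereal (p x))"
      and u: "0 \<le> u" "u \<le> 1"
    define z where "z = (1 - u) *\<^sub>R x + u *\<^sub>R y"
    have "(1 - u) *\<^sub>R (x, a - p x) + u *\<^sub>R (y, b - p y) \<in> ereal_epigraph f"
      using f a b u unfolding shift convex_alt by blast
    then have "f z \<le> ereal ((1 - u) * (a - p x) + u * (b - p y))"
      by (simp add: ereal_epigraph_def z_def)
    also have "\<dots> \<le> ereal ((1 - u) * a + u * b - p z)"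
      using convex_onD[OF p u, of x y] by (simp add: z_def algebra_simps)
    finally show "(1 - u) *\<^sub>R (x, a) + u *\<^sub>R (y, b) \<in> ereal_epigraph (\<lambda>x. f x + ereal (p x))"
      using shift[of z "(1 - u) * a + u * b"] by (simp add: ereal_epigraph_def z_def)
  qed
qed

text \<open>Plain optimality of \<open>x\<close>, compared with the value at \<open>y\<close>, gives only half of the quadratic
  term. The full term comes from comparing \<open>x\<close> with points \<open>(1 - t) x + t y\<close> close to it: the
  quadratic is multiplied by \<open>(1 - t)\<^sup>2 = 1 - 2 t + t\<^sup>2\<close>, so it loses twice the fraction \<open>t\<close> to
  first order, whereas convexity lets \<open>f\<close> rise by at most \<open>t (b - a)\<close>.\<close>

lemma prox_minimizer_decrease:
  fixes f :: "real^'m \<Rightarrow> ereal"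
  assumes f: "convex (ereal_epigraph f)"
    and min: "is_arg_min (\<lambda>z. f z + ereal (1/2 * ((z - y) \<bullet> (Q *v (z - y))))) (\<lambda>_. True) x"
    and fx: "f x = ereal a" and fy: "f y = ereal b"
  shows "a + (x - y) \<bullet> (Q *v (x - y)) \<le> b"
proof -
  define q where "q = (x - y) \<bullet> (Q *v (x - y))"
  have bound: "a + q - b \<le> t * q / 2" if t: "0 < t" "t < 1" for t
  proof -
    define z where "z = (1 - t) *\<^sub>R x + t *\<^sub>R y"
    have "(1 - t) *\<^sub>R (x, a) + t *\<^sub>R (y, b) \<in> ereal_epigraph f"
      using f fx fy t unfolding convex_alt by (simp add: ereal_epigraph_def)
    then have fz: "f z \<le> ereal ((1 - t) * a + t * b)"
      by (simp add: ereal_epigraph_def z_def)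
    have zy: "z - y = (1 - t) *\<^sub>R (x - y)" by (simp add: z_def algebra_simps)
    have qz: "(z - y) \<bullet> (Q *v (z - y)) = (1 - t)\<^sup>2 * q"
      unfolding zy by (simp add: q_def matrix_vector_mult_scaleR power2_eq_square)
    have "f x + ereal (1/2 * q) \<le> f z + ereal (1/2 * ((1 - t)\<^sup>2 * q))"
      using min[unfolded is_arg_min_def simp_thms not_ex not_less, rule_format, of z]
      unfolding qz q_def[symmetric] .
    also have "\<dots> \<le> ereal ((1 - t) * a + t * b) + ereal (1/2 * ((1 - t)\<^sup>2 * q))"
      using fz by (rule add_right_mono)
    finally have "a + q / 2 \<le> (1 - t) * a + t * b + (1 - t)\<^sup>2 * q / 2"
      by (simp add: fx)
    then have "t * (a + q - b) \<le> t * (t * q / 2)"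
      by (simp add: power2_eq_square field_simps)
    then show ?thesis using t by simp
  qed
  have "((\<lambda>t. t * q / 2) \<longlongrightarrow> 0 * q / 2) (at_right 0)"
    by (intro tendsto_intros) auto
  moreover have "\<forall>\<^sub>F t in at_right 0. a + q - b \<le> t * q / 2"
    unfolding eventually_at_right_field using bound by (intro exI[of _ 1]) auto
  ultimately have "a + q - b \<le> 0 * q / 2"
    by (rule tendsto_lowerbound) simp
  then show ?thesis by (simp add: q_def)
qed

section \<open>The model near its base point\<close>

text \<open>Splitting off the real-valued part leaves \<open>g\<close> as the only source of infinite values, so the
  estimates below are estimates between real numbers.\<close>

definition model_finite_part :: "(real^'d \<Rightarrow> real) \<Rightarrow> (real^'m \<Rightarrow> real^'d) \<Rightarrow>
    (real^'n \<Rightarrow> real) \<Rightarrow> ('n \<Rightarrow> real^'m \<Rightarrow> real) \<Rightarrow> real^'m \<Rightarrow> real^'m \<Rightarrow> real" where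
  "model_finite_part h C s r xk x =
     h (C xk + jacobian C (at xk) *v (x - xk)) + s (Rmap r xk)
       + (\<Sum>i\<in>UNIV. grad s (Rmap r xk) $ i * Phi s r xk i x)"

lemma model_eq_add_finite_part:
  "model g h C s r xk x = g x + ereal (model_finite_part h C s r xk x)"
  by (simp add: model_def model_finite_part_def add.assoc)

lemma model_finite_part_at_base:
  "model_finite_part h C s r xk xk = h (C xk) + s (Rmap r xk)"
proof -
  have "Phi s r xk i xk = 0" for i by (simp add: Phi_def)
  then show ?thesis by (simp add: model_finite_part_def)
qed

text \<open>Each summand is convex because a nonnegative weight multiplies the convex \<open>r i\<close>, while a
  negative weight multiplies a linear function.\<close>

lemma convex_model_finite_part:
  assumes h: "convex_on UNIV h" and r: "\<And>i. convex_on UNIV (r i)"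
  shows "convex_on UNIV (model_finite_part h C s r xk)"
proof -
  have const: "convex_on UNIV (\<lambda>x::real^'m. c)" for c :: real
    by (simp add: convex_on_def flip: distrib_right)
  have sum: "convex_on UNIV (\<lambda>x. \<Sum>i\<in>I. f i x)"
    if "\<And>i. convex_on UNIV (f i)" for I and f :: "'i \<Rightarrow> real^'m \<Rightarrow> real"
    by (induction I rule: infinite_finite_induct) (simp_all add: const convex_on_add that)
  have weighted: "convex_on UNIV (\<lambda>x. w $ i * (if 0 \<le> w $ i then r i x - r i xk else v \<bullet> (x - xk)))"
    for w i v
  proof (cases "0 \<le> w $ i")
    case True
    then show ?thesis
      using convex_on_cmul[OF True convex_on_add[OF r[of i] const[of "- r i xk"]]] by simp
  next
    case False
    have "convex_on UNIV (\<lambda>x. (w $ i *\<^sub>R v) \<bullet> (x - xk))"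
      by (rule convex_onI) (simp_all add: inner_add_right inner_diff_right algebra_simps)
    with False show ?thesis by simp
  qed
  show ?thesis
    unfolding model_finite_part_def Phi_def
    by (rule convex_on_add convex_on_affine_compose[OF h] matrix_vector_mul_linear
        const sum weighted)+
qed

text \<open>Two errors are made. The Lipschitz function \<open>h\<close> sees the linearization error of \<open>C\<close>.
  Replacing \<open>s\<close> by its linearization costs \<open>\<beta>\<^sub>s / 2\<close> times the squared displacement of
  the inner map; the remaining linearization of \<open>r i\<close> happens only under a negative weight, and
  there the tangent inequality for the convex \<open>r i\<close> errs in the favourable direction.\<close>

lemma finite_part_le_model:
  fixes C :: "real^'m \<Rightarrow> real^'d" and s :: "real^'n \<Rightarrow> real"
    and r :: "'n \<Rightarrow> real^'m \<Rightarrow> real"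
  assumes C: "C1_on C UNIV" and s: "C1_on s UNIV"
    and r: "\<And>i. convex_on UNIV (r i)"
    and h_lip: "L_h-lipschitz_on UNIV h"
    and C_lip: "\<And>z. spectral_norm (jacobian C (at z) - jacobian C (at xk)) \<le> \<beta>\<^sub>C * norm (z - xk)"
    and s_lip: "\<beta>\<^sub>s-lipschitz_on UNIV (grad s)"
    and r_lip: "\<And>i. (L i)-lipschitz_on UNIV (r i)"
    and neg: "\<And>i. grad s (Rmap r xk) $ i < 0 \<Longrightarrow> C1_on (r i) UNIV"
  shows "h (C x) + s (Rmap r x) \<le> model_finite_part h C s r xk x
    + (L_h * \<beta>\<^sub>C + (norm (\<chi> i. L i))\<^sup>2 * \<beta>\<^sub>s) / 2 * (norm (x - xk))\<^sup>2"
proof -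
  define d where "d = x - xk"
  define w where "w = grad s (Rmap r xk)"
  let ?J = "\<lambda>z. jacobian C (at z)"
  have C_err: "norm (C x - C xk - ?J xk *v (x - xk)) \<le> \<beta>\<^sub>C / 2 * (norm (x - xk))\<^sup>2"
  proof (rule linearization_error_le)
    show "(C has_derivative (*v) (?J z)) (at z)" for z
      using C jacobian_works[of C "at z"] unfolding C1_on_def differentiable_def by blast
    show "norm (?J z *v v - ?J xk *v v) \<le> \<beta>\<^sub>C * norm (z - xk) * norm v" for z v
    proof -
      have "norm ((?J z - ?J xk) *v v) \<le> spectral_norm (?J z - ?J xk) * norm v"
        unfolding spectral_norm_def by (intro onorm matrix_vector_mul_bounded_linear)
      also have "\<dots> \<le> \<beta>\<^sub>C * norm (z - xk) * norm v"
        using C_lip by (intro mult_right_mono) auto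
      finally show ?thesis by (simp add: matrix_vector_mult_diff_rdistrib)
    qed
  qed
  have "h (C x) - h (C xk + ?J xk *v d) \<le> L_h * norm (C x - (C xk + ?J xk *v d))"
    using lipschitz_onD[OF h_lip, of "C x" "C xk + ?J xk *v d"] by (simp add: dist_norm)
  also have "\<dots> \<le> L_h * (\<beta>\<^sub>C / 2 * (norm d)\<^sup>2)"
    using C_err lipschitz_on_nonneg[OF h_lip]
    by (intro mult_left_mono) (auto simp: d_def algebra_simps)
  finally have h_part: "h (C x) - h (C xk + ?J xk *v d) \<le> L_h * \<beta>\<^sub>C / 2 * (norm d)\<^sup>2"
    by simp
  define D where "D = Rmap r x - Rmap r xk"
  have "norm (s (Rmap r x) - s (Rmap r xk) - D \<bullet> w) \<le> \<beta>\<^sub>s / 2 * (norm D)\<^sup>2"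
    unfolding D_def w_def
  proof (rule linearization_error_le)
    show "(s has_derivative (\<lambda>v. v \<bullet> grad s z)) (at z)" for z
      by (rule C1_on_has_derivative_grad[OF s])
    show "norm (v \<bullet> grad s z - v \<bullet> grad s (Rmap r xk)) \<le> \<beta>\<^sub>s * norm (z - Rmap r xk) * norm v" for z v
    proof -
      have "norm (v \<bullet> (grad s z - grad s (Rmap r xk)))
          \<le> norm v * norm (grad s z - grad s (Rmap r xk))"
        using Cauchy_Schwarz_ineq2 by simp
      also have "\<dots> \<le> norm v * (\<beta>\<^sub>s * norm (z - Rmap r xk))"
        using lipschitz_onD[OF s_lip] by (intro mult_left_mono) (auto simp: dist_norm)
      finally show ?thesis by (simp add: inner_diff_right mult_ac)
    qed
  qed
  moreover have "\<beta>\<^sub>s / 2 * (norm D)\<^sup>2 \<le> \<beta>\<^sub>s / 2 * (norm (\<chi> i. L i) * norm d)\<^sup>2"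
    unfolding D_def d_def using lipschitz_on_nonneg[OF s_lip]
    by (intro mult_left_mono power_mono Rmap_norm_diff_le[OF r_lip]) auto
  ultimately have "s (Rmap r x) - s (Rmap r xk) - D \<bullet> w
      \<le> \<beta>\<^sub>s / 2 * (norm (\<chi> i. L i) * norm d)\<^sup>2"
    unfolding real_norm_def by linarith
  then have s_part: "s (Rmap r x) - s (Rmap r xk) - D \<bullet> w
      \<le> (norm (\<chi> i. L i))\<^sup>2 * \<beta>\<^sub>s / 2 * (norm d)\<^sup>2"
    by (simp add: power_mult_distrib mult_ac)
  have "D \<bullet> w = (\<Sum>i\<in>UNIV. w $ i * (r i x - r i xk))"
    by (simp add: D_def Rmap_def inner_vec_def mult.commute)
  also have "\<dots> \<le> (\<Sum>i\<in>UNIV. w $ i * Phi s r xk i x)"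
  proof (rule sum_mono)
    fix i
    show "w $ i * (r i x - r i xk) \<le> w $ i * Phi s r xk i x"
    proof (cases "0 \<le> w $ i")
      case False
      then have "grad (r i) xk \<bullet> (x - xk) \<le> r i x - r i xk"
        using neg by (intro convex_ge_tangent r C1_on_has_derivative_grad) (auto simp: w_def)
      with False show ?thesis by (simp add: Phi_def w_def mult_left_mono_neg)
    qed (simp add: Phi_def w_def)
  qed
  finally have "D \<bullet> w \<le> (\<Sum>i\<in>UNIV. w $ i * Phi s r xk i x)" .
  with h_part s_part show ?thesis
    unfolding model_finite_part_def w_def[symmetric] d_def[symmetric]
    by (simp add: algebra_simps add_divide_distrib)
qed

section \<open>Acceptance of the trial point\<close>

theorem lemma3p2:
  fixes g :: "real^'m \<Rightarrow> ereal"
    and h :: "real^'d \<Rightarrow> real"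
    and C :: "real^'m \<Rightarrow> real^'d"
    and s :: "real^'n \<Rightarrow> real"
    and r :: "'n \<Rightarrow> real^'m \<Rightarrow> real"
    and x0 xk xp :: "real^'m"
    and Q :: "real^'m^'m"
    and L_h beta_C beta_s L_s alpha1 :: real
    and L_r beta_r :: "'n \<Rightarrow> real"
  defines "F \<equiv> objective g h C s r"
    and "X0 \<equiv> level_set (objective g h C s r) x0"
    and "L_R \<equiv> norm (\<chi> i. L_r i)"
  defines "L_U \<equiv> L_h * beta_C + L_R\<^sup>2 * beta_s"
    and "Pred \<equiv> F xk - prox_model g h C s r Q xk xp"
    and "Act \<equiv> F xk - F xp"
  assumes g: "proper_closed_convex g"
    and h: "closed_convex h"
    and C: "C1_on C UNIV"
    and s: "C1_on s UNIV"
    and r: "\<And>i. closed_convex (r i)"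
    and mono_or_smooth: "monotone_or_smooth F s r"
    and x0: "x0 \<in> eff_dom F"
    and X0: "X0 \<noteq> {}" "compact X0"
    and h_lip: "L_h-lipschitz_on UNIV h"
    and C_lip: "\<And>x y. spectral_norm (jacobian C (at x) - jacobian C (at y)) \<le> beta_C * norm (x - y)"
    and s_lip: "beta_s-lipschitz_on UNIV (grad s)"
    and r_lip: "\<And>i. (L_r i)-lipschitz_on UNIV (r i)"
    and neg_s: "neg_indices s r X0 \<noteq> {} \<Longrightarrow>
                  (\<forall>y \<in> {Rmap r x | x. F x \<le> F x0}. norm (grad s y) \<le> L_s)"
    and neg_r: "\<And>i. i \<in> neg_indices s r X0 \<Longrightarrow>
                  C1_on (r i) UNIV \<and> (beta_r i)-lipschitz_on UNIV (grad (r i))"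
    and alpha1: "0 < alpha1" "alpha1 < 1"
    and xk: "xk \<in> X0"
    and Q: "sym_pos_def Q"
    and xp: "is_arg_min (prox_model g h C s r Q xk) (\<lambda>_. True) xp"
    and Pred: "Pred \<noteq> 0"
    and sigma: "lambda_min Q \<ge> L_U / (2 - alpha1)"
  shows "Act / Pred \<ge> ereal alpha1"
proof -
  define d where "d = xp - xk"
  define q where "q = d \<bullet> (Q *v d)"
  define p where "p = model_finite_part h C s r xk"
  define \<phi> where "\<phi> x = h (C x) + s (Rmap r x)" for x
  have F: "F x = g x + ereal (\<phi> x)" for x
    by (simp add: F_def objective_def \<phi>_def add.assoc)
  have prox: "prox_model g h C s r Q xk
      = (\<lambda>x. model g h C s r xk x + ereal (1/2 * ((x - xk) \<bullet> (Q *v (x - xk)))))"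
    by (auto simp: prox_model_def)
  have model: "model g h C s r xk = (\<lambda>x. g x + ereal (p x))"
    by (auto simp: model_eq_add_finite_part p_def)
  have pk: "p xk = \<phi> xk"
    by (simp add: p_def \<phi>_def model_finite_part_at_base)
  have g_ninf: "g x \<noteq> -\<infinity>" for x
    using g by (simp add: proper_closed_convex_def proper_fun_def)
  have "g xk + ereal (\<phi> xk) < \<infinity>"
    using xk F by (simp add: X0_def level_set_def eff_dom_def F_def)
  then obtain b where gk: "g xk = ereal b"
    using g_ninf[of xk] by (cases "g xk") auto
  \<comment> \<open>The proximal model is finite at its base point, hence also at its minimizer.\<close>
  have "prox_model g h C s r Q xk xp \<le> prox_model g h C s r Q xk xk"
    using xp by (simp add: is_arg_min_def not_less)
  then obtain a where gp: "g xp = ereal a"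
    using g_ninf[of xp] by (cases "g xp") (auto simp: prox model gk)

  have "a + p xp + d \<bullet> (Q *v d) \<le> b + p xk"
    unfolding d_def
  proof (rule prox_minimizer_decrease)
    show "convex (ereal_epigraph (model g h C s r xk))"
      unfolding model p_def using g h r
      by (intro convex_ereal_epigraph_add convex_model_finite_part)
        (auto simp: proper_closed_convex_def closed_convex_def)
    show "is_arg_min (\<lambda>x. model g h C s r xk x + ereal (1/2 * ((x - xk) \<bullet> (Q *v (x - xk)))))
        (\<lambda>_. True) xp"
      using xp unfolding prox .
  qed (simp_all add: model gp gk)
  then have dec: "a + p xp + q \<le> b + \<phi> xk"
    by (simp add: q_def pk)

  have "\<phi> xp \<le> p xp + (L_h * beta_C + (norm (\<chi> i. L_r i))\<^sup>2 * beta_s) / 2 * (norm (xp - xk))\<^sup>2"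
    unfolding \<phi>_def p_def
  proof (rule finite_part_le_model)
    show "C1_on (r i) UNIV" if "grad s (Rmap r xk) $ i < 0" for i
      using neg_r xk that by (auto simp: neg_indices_def)
    show "convex_on UNIV (r i)" for i using r by (simp add: closed_convex_def)
  qed (fact C s h_lip C_lip s_lip r_lip)+
  then have upper: "\<phi> xp \<le> p xp + L_U / 2 * (d \<bullet> d)"
    by (simp add: L_U_def L_R_def d_def dot_square_norm)

  have "L_U \<le> (2 - alpha1) * lambda_min Q"
    using sigma alpha1 by (simp add: pos_divide_le_eq mult.commute)
  then have "L_U * (d \<bullet> d) \<le> (2 - alpha1) * (lambda_min Q * (d \<bullet> d))"
    by (metis inner_ge_zero mult.assoc mult_right_mono)
  also have "\<dots> \<le> (2 - alpha1) * q"
    unfolding q_def using Q alpha1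
    by (intro mult_left_mono lambda_min_rayleigh) (auto simp: sym_pos_def_def)
  finally have curv: "L_U * (d \<bullet> d) \<le> (2 - alpha1) * q" .

  define P where "P = b + \<phi> xk - (a + p xp + q / 2)"
  define A where "A = b + \<phi> xk - (a + \<phi> xp)"
  have PredP: "Pred = ereal P"
    by (simp add: Pred_def F prox model gp gk P_def q_def d_def)
  have ActA: "Act = ereal A"
    by (simp add: Act_def F gp gk A_def)
  have "0 \<le> q"
    using Q by (cases "d = 0") (auto simp: q_def sym_pos_def_def less_imp_le)
  have Pq: "q / 2 \<le> P" using dec by (simp add: P_def)
  have "0 < P" using Pq \<open>0 \<le> q\<close> Pred PredP by (auto simp: zero_ereal_def)
  have "P + q / 2 - L_U / 2 * (d \<bullet> d) \<le> A"
    using upper by (simp add: A_def P_def)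
  \<comment> \<open>The share of \<open>P\<close> that acceptance does not claim pays for part of the model error.\<close>
  moreover have "(1 - alpha1) * (q / 2) \<le> (1 - alpha1) * P"
    using Pq alpha1 by (intro mult_left_mono) auto
  moreover have "(1 - alpha1) * (q / 2) + q / 2 = (2 - alpha1) * q / 2"
    by (simp add: field_simps)
  moreover have "(1 - alpha1) * P = P - alpha1 * P"
    by (simp add: left_diff_distrib)
  ultimately have "alpha1 * P \<le> A"
    using curv by linarith
  then show ?thesis
    using \<open>0 < P\<close> by (simp add: PredP ActA pos_le_divide_eq)
qed

end
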